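(* Let $\psi_1,\psi_2$ be $\mathcal{T}$-formulas in d-DNNF which are $\mathcal{T}$-extended with respect to a finite set of atoms $\boldsymbol{\alpha}$ containing their atoms. (a) If $\psi_1,\psi_2$ belong to a form of d-DNNF for which $\psi_1\equiv_{\mathcal{B}}\psi_2$ can be decided in polynomial time (e.g., OBDDs with the same variable ordering, or SDDs with the same vtree), then $\psi_1\equiv_{\mathcal{T}}\psi_2$ can be decided in polynomial time. (b) If $\psi_1,\psi_2$ belong to a form of d-DNNF for which $\psi_1\models_p\psi_2$ can be decided in polynomial time (e.g., OBDDs with the same variable ordering, or SDDs with the same vtree), then $\psi_1\models_{\mathcal{T}}\psi_2$ can be decided in polynomial time.
   Context: $\mathcal{T}$-formulas are quantifier-free formulas built by Boolean connectives from $\mathcal{T}$-atoms and Boolean atoms, represented as DAGs. The Boolean abstraction maps each atom bijectively to a fresh Boolean variable; $\psi\models_p\chi$ means the abstraction of $\psi$ propositionally entails that of $\chi$, and $\equiv_{\mathcal{B}}$ is mutual $\models_p$; $\models_{\mathcal{T}},\equiv_{\mathcal{T}}$ are entailment/equivalence modulo $\mathcal{T}$. d-DNNF: negation normal form in which children of every $\wedge$-node share no atoms and children of every $\vee$-node are pairwise propositionally inconsistent; a $\mathcal{T}$-formula is in a given form iff its Boolean abstraction is. A total truth assignment on $\boldsymbol{\alpha}$ is a conjunction containing, for each $a\in\boldsymbol{\alpha}$, exactly one of $a,\neg a$. $P_{\boldsymbol{\alpha}}(\chi)$ is the set of $\mathcal{T}$-unsatisfiable total truth assignments $\rho$ on $\boldsymbol{\alpha}$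 with $\rho\models_p\chi$; $\psi$ is $\mathcal{T}$-extended with respect to $\boldsymbol{\alpha}$ iff $P_{\boldsymbol{\alpha}}(\neg\psi)=\emptyset$. *)

theory Defs
  imports Main
begin

section \<open>Propositional formulas\<close>

datatype (atoms: 'v) fm =
    Tru
  | Fls
  | Atom 'v
  | Neg "'v fm"
  | Conj "'v fm list"
  | Disj "'v fm list"

fun eval :: "('v \<Rightarrow> bool) \<Rightarrow> 'v fm \<Rightarrow> bool" where
  "eval I Tru = True"
| "eval I Fls = False"
| "eval I (Atom v) = I v"
| "eval I (Neg f) = (\<not> eval I f)"
| "eval I (Conj fs) = (\<forall>f\<in>set fs. eval I f)"
| "eval I (Disj fs) = (\<exists>f\<in>set fs. eval I f)"

definition prop_entails :: "'v fm \<Rightarrow> 'v fm \<Rightarrow> bool" where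
  "prop_entails f g \<longleftrightarrow> (\<forall>I. eval I f \<longrightarrow> eval I g)"

definition prop_inconsistent :: "'v fm \<Rightarrow> 'v fm \<Rightarrow> bool" where
  "prop_inconsistent f g \<longleftrightarrow> (\<nexists>I. eval I f \<and> eval I g)"

text \<open>Negation normal form, decomposability of every conjunction and determinism of every
  disjunction.  Children are compared at distinct positions of the list.\<close>

fun d_dnnf :: "'v fm \<Rightarrow> bool" where
  "d_dnnf Tru = True"
| "d_dnnf Fls = True"
| "d_dnnf (Atom v) = True"
| "d_dnnf (Neg f) = (\<exists>v. f = Atom v)"
| "d_dnnf (Conj fs) =
    ((\<forall>f\<in>set fs. d_dnnf f) \<and> sorted_wrt (\<lambda>f g. atoms f \<inter> atoms g = {}) fs)"
| "d_dnnf (Disj fs) =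
    ((\<forall>f\<in>set fs. d_dnnf f) \<and> sorted_wrt prop_inconsistent fs)"

section \<open>DAGs\<close>

text \<open>A DAG is the list of its nodes in a topological order: every node refers to its children
  by their positions, which precede its own, and the last node is the root.\<close>

datatype 'v node =
    NTru
  | NFls
  | NAtom 'v
  | NNeg nat
  | NConj "nat list"
  | NDisj "nat list"

type_synonym 'v dag = "'v node list"

fun children :: "'v node \<Rightarrow> nat set" where
  "children (NNeg i) = {i}"
| "children (NConj is) = set is"
| "children (NDisj is) = set is"
| "children _ = {}"

definition wf_dag :: "'v dag \<Rightarrow> bool" where
  "wf_dag d \<longleftrightarrow> d \<noteq> [] \<and> (\<forall>i<length d. \<forall>j\<in>children (d ! i). j < i)"

fun node_fm :: "'v fm list \<Rightarrow> 'v node \<Rightarrow> 'v fm" where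
  "node_fm fs NTru = Tru"
| "node_fm fs NFls = Fls"
| "node_fm fs (NAtom v) = Atom v"
| "node_fm fs (NNeg i) = Neg (fs ! i)"
| "node_fm fs (NConj is) = Conj (map ((!) fs) is)"
| "node_fm fs (NDisj is) = Disj (map ((!) fs) is)"

definition dag_fm :: "'v dag \<Rightarrow> 'v fm" where
  "dag_fm d = last (foldl (\<lambda>fs n. fs @ [node_fm fs n]) [] d)"

definition d_dnnf_dag :: "'v dag \<Rightarrow> bool" where
  "d_dnnf_dag d \<longleftrightarrow> wf_dag d \<and> d_dnnf (dag_fm d)"

section \<open>Atoms and theories\<close>

text \<open>Many-sorted first-order logic with equality.  Sorts, symbols and variables are named by
  strings, so that formulas are finite objects that can be written on a tape.  A variable
  carries its sort.\<close>

type_synonym name = string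

datatype trm = Var name name | App name "trm list"

datatype atom = Pred name "trm list" | Eq trm trm | BoolAtom name

record fo_sig =
  fun_sorts :: "name \<Rightarrow> (name list \<times> name) option"
  pred_sorts :: "name \<Rightarrow> name list option"

inductive has_sort :: "fo_sig \<Rightarrow> trm \<Rightarrow> name \<Rightarrow> bool" for Sg where
  "has_sort Sg (Var x s) s"
| "fun_sorts Sg f = Some (ss, s) \<Longrightarrow> list_all2 (has_sort Sg) ts ss \<Longrightarrow> has_sort Sg (App f ts) s"

fun wf_atom :: "fo_sig \<Rightarrow> atom \<Rightarrow> bool" where
  "wf_atom Sg (Pred p ts) = (\<exists>ss. pred_sorts Sg p = Some ss \<and> list_all2 (has_sort Sg) ts ss)"
| "wf_atom Sg (Eq t u) = (\<exists>s. has_sort Sg t s \<and> has_sort Sg u s)"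
| "wf_atom Sg (BoolAtom b) = True"

record 'u struct =
  dom_of :: "name \<Rightarrow> 'u set"
  fun_of :: "name \<Rightarrow> 'u list \<Rightarrow> 'u"
  pred_of :: "name \<Rightarrow> 'u list \<Rightarrow> bool"

definition is_struct :: "fo_sig \<Rightarrow> 'u struct \<Rightarrow> bool" where
  "is_struct Sg S \<longleftrightarrow>
     (\<forall>s. dom_of S s \<noteq> {}) \<and>
     (\<forall>f ss s xs. fun_sorts Sg f = Some (ss, s) \<longrightarrow>
        list_all2 (\<lambda>x r. x \<in> dom_of S r) xs ss \<longrightarrow> fun_of S f xs \<in> dom_of S s)"

text \<open>As usual in SMT, a theory is a class of structures over a signature.\<close>

definition is_theory :: "fo_sig \<Rightarrow> 'u struct set \<Rightarrow> bool" where
  "is_theory Sg T \<longleftrightarrow> (\<forall>S\<in>T. is_struct Sg S)"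

fun trm_val :: "'u struct \<Rightarrow> (name \<Rightarrow> name \<Rightarrow> 'u) \<Rightarrow> trm \<Rightarrow> 'u" where
  "trm_val S \<nu> (Var x s) = \<nu> x s"
| "trm_val S \<nu> (App f ts) = fun_of S f (map (trm_val S \<nu>) ts)"

fun atom_val :: "'u struct \<Rightarrow> (name \<Rightarrow> name \<Rightarrow> 'u) \<Rightarrow> (name \<Rightarrow> bool) \<Rightarrow> atom \<Rightarrow> bool" where
  "atom_val S \<nu> \<beta> (Pred p ts) = pred_of S p (map (trm_val S \<nu>) ts)"
| "atom_val S \<nu> \<beta> (Eq t u) = (trm_val S \<nu> t = trm_val S \<nu> u)"
| "atom_val S \<nu> \<beta> (BoolAtom b) = \<beta> b"

definition theory_interps :: "'u struct set \<Rightarrow> (atom \<Rightarrow> bool) set" where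
  "theory_interps T = {atom_val S \<nu> \<beta> | S \<nu> \<beta>. S \<in> T \<and> (\<forall>x s. \<nu> x s \<in> dom_of S s)}"

definition T_sat :: "'u struct set \<Rightarrow> atom fm \<Rightarrow> bool" where
  "T_sat T f \<longleftrightarrow> (\<exists>I\<in>theory_interps T. eval I f)"

definition T_entails :: "'u struct set \<Rightarrow> atom fm \<Rightarrow> atom fm \<Rightarrow> bool" where
  "T_entails T f g \<longleftrightarrow> (\<forall>I\<in>theory_interps T. eval I f \<longrightarrow> eval I g)"

definition T_equiv :: "'u struct set \<Rightarrow> atom fm \<Rightarrow> atom fm \<Rightarrow> bool" where
  "T_equiv T f g \<longleftrightarrow> (\<forall>I\<in>theory_interps T. eval I f \<longleftrightarrow> eval I g)"

section \<open>Boolean abstraction\<close>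

datatype bvar = Fresh atom

definition abs_fm :: "atom fm \<Rightarrow> bvar fm" where
  "abs_fm = map_fm Fresh"

definition abs_dag :: "atom dag \<Rightarrow> bvar dag" where
  "abs_dag = map (map_node Fresh)"

definition p_entails :: "atom fm \<Rightarrow> atom fm \<Rightarrow> bool" where
  "p_entails f g \<longleftrightarrow> prop_entails (abs_fm f) (abs_fm g)"

definition B_equiv :: "atom fm \<Rightarrow> atom fm \<Rightarrow> bool" where
  "B_equiv f g \<longleftrightarrow> p_entails f g \<and> p_entails g f"

definition T_formula :: "fo_sig \<Rightarrow> atom dag \<Rightarrow> bool" where
  "T_formula Sg d \<longleftrightarrow> wf_dag d \<and> (\<forall>n\<in>set d. \<forall>a\<in>set_node n. wf_atom Sg a)"

definition in_form :: "bvar dag set \<Rightarrow> atom dag \<Rightarrow> bool" where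
  "in_form F d \<longleftrightarrow> abs_dag d \<in> F"

section \<open>T-extended formulas\<close>

definition total_assignment :: "atom set \<Rightarrow> atom fm \<Rightarrow> bool" where
  "total_assignment \<alpha> \<rho> \<longleftrightarrow>
     (\<exists>ls. \<rho> = Conj ls \<and>
        (\<forall>l\<in>set ls. \<exists>a\<in>\<alpha>. l = Atom a \<or> l = Neg (Atom a)) \<and>
        (\<forall>a\<in>\<alpha>. (Atom a \<in> set ls) \<noteq> (Neg (Atom a) \<in> set ls)))"

definition P_set :: "'u struct set \<Rightarrow> atom set \<Rightarrow> atom fm \<Rightarrow> atom fm set" where
  "P_set T \<alpha> f = {\<rho>. total_assignment \<alpha> \<rho> \<and> \<not> T_sat T \<rho> \<and> p_entails \<rho> f}"

definition T_extended :: "'u struct set \<Rightarrow> atom set \<Rightarrow> atom fm \<Rightarrow> bool" where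
  "T_extended T \<alpha> f \<longleftrightarrow> P_set T \<alpha> (Neg f) = {}"

section \<open>Instances\<close>

text \<open>A form of d-DNNF is given by a family \<open>F\<close> of classes of DAGs.  The index stands for whatever
  two formulas have to share (a variable ordering, a vtree); a one-point index type yields a
  single class.\<close>

definition form_instances ::
  "fo_sig \<Rightarrow> ('p \<Rightarrow> bvar dag set) \<Rightarrow> (atom dag \<times> atom dag) set" where
  "form_instances Sg F = {(\<psi>1, \<psi>2). T_formula Sg \<psi>1 \<and> T_formula Sg \<psi>2 \<and>
     (\<exists>p. in_form (F p) \<psi>1 \<and> in_form (F p) \<psi>2)}"

text \<open>The set \<open>\<alpha>\<close> varies with the instance and is not part of the input: for a fixed \<open>\<alpha>\<close>
  there would be only finitely many formulas up to equivalence.\<close>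

definition extended_instances ::
  "fo_sig \<Rightarrow> 'u struct set \<Rightarrow> ('p \<Rightarrow> bvar dag set) \<Rightarrow> (atom dag \<times> atom dag) set" where
  "extended_instances Sg T F = {(\<psi>1, \<psi>2). (\<psi>1, \<psi>2) \<in> form_instances Sg F \<and>
     (\<exists>\<alpha>. finite \<alpha> \<and> (\<forall>a\<in>\<alpha>. wf_atom Sg a) \<and>
        atoms (dag_fm \<psi>1) \<subseteq> \<alpha> \<and> atoms (dag_fm \<psi>2) \<subseteq> \<alpha> \<and>
        T_extended T \<alpha> (dag_fm \<psi>1) \<and> T_extended T \<alpha> (dag_fm \<psi>2))}"

section \<open>Polynomial-time decidability\<close>

text \<open>Deterministic Turing machines with one two-way infinite tape.  Symbol 0 is the blank;
  states 0, 1 and 2 are the initial, the accepting and the rejecting state.\<close>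

datatype move = MoveLeft | Stay | MoveRight

record tm =
  num_states :: nat
  num_symbols :: nat
  delta :: "nat \<Rightarrow> nat \<Rightarrow> nat \<times> nat \<times> move"

definition wf_tm :: "tm \<Rightarrow> bool" where
  "wf_tm M \<longleftrightarrow> 3 \<le> num_states M \<and> 1 \<le> num_symbols M \<and>
     (\<forall>q<num_states M. \<forall>a<num_symbols M. \<forall>q' b m.
        delta M q a = (q', b, m) \<longrightarrow> q' < num_states M \<and> b < num_symbols M)"

type_synonym config = "nat \<times> (int \<Rightarrow> nat) \<times> int"

fun move_head :: "move \<Rightarrow> int \<Rightarrow> int" where
  "move_head MoveLeft h = h - 1"
| "move_head Stay h = h"
| "move_head MoveRight h = h + 1"

fun step :: "tm \<Rightarrow> config \<Rightarrow> config" where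
  "step M (q, tp, h) =
     (if q = 1 \<or> q = 2 then (q, tp, h)
      else case delta M q (tp h) of (q', b, m) \<Rightarrow> (q', tp(h := b), move_head m h))"

definition init_config :: "nat list \<Rightarrow> config" where
  "init_config w = (0, \<lambda>i. if 0 \<le> i \<and> i < int (length w) then w ! nat i else 0, 0)"

text \<open>Decidability of a promise problem: instances \<open>X\<close>, encoding \<open>enc\<close>, question \<open>Q\<close>.
  Halting states are never left, so the state reached after exactly the time bound is
  the answer given within the time bound.  Bounding the input symbols by the size of the
  alphabet makes the relevant part of the transition function finite.\<close>

definition poly_time_decidable :: "'i set \<Rightarrow> ('i \<Rightarrow> nat list) \<Rightarrow> ('i \<Rightarrow> bool) \<Rightarrow> bool" where
  "poly_time_decidable X enc Q \<longleftrightarrow>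
     (\<exists>M c k. wf_tm M \<and>
        (\<forall>x\<in>X. set (enc x) \<subseteq> {1..<num_symbols M} \<and>
           fst ((step M ^^ (c * length (enc x) ^ k + c)) (init_config (enc x)))
             = (if Q x then 1 else 2)))"

section \<open>Writing DAGs on a tape\<close>

datatype sexp = Leaf string | Node "sexp list"

fun ser :: "sexp \<Rightarrow> nat list" where
  "ser (Leaf s) = map (\<lambda>c. 4 + of_char c) s @ [1]"
| "ser (Node xs) = 2 # concat (map ser xs) @ [3]"

text \<open>Binary, least significant bit first.\<close>

fun binary :: "nat \<Rightarrow> string" where
  "binary n = (if n = 0 then [] else (if odd n then CHR ''1'' else CHR ''0'') # binary (n div 2))"

declare binary.simps [simp del]

fun trm_sexp :: "trm \<Rightarrow> sexp" where
  "trm_sexp (Var x s) = Node [Leaf ''var'', Leaf x, Leaf s]"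
| "trm_sexp (App f ts) = Node (Leaf ''app'' # Leaf f # map trm_sexp ts)"

fun atom_sexp :: "atom \<Rightarrow> sexp" where
  "atom_sexp (Pred p ts) = Node (Leaf ''pred'' # Leaf p # map trm_sexp ts)"
| "atom_sexp (Eq t u) = Node [Leaf ''eq'', trm_sexp t, trm_sexp u]"
| "atom_sexp (BoolAtom b) = Node [Leaf ''bool'', Leaf b]"

fun node_sexp :: "atom node \<Rightarrow> sexp" where
  "node_sexp NTru = Node [Leaf ''true'']"
| "node_sexp NFls = Node [Leaf ''false'']"
| "node_sexp (NAtom a) = Node [Leaf ''atom'', atom_sexp a]"
| "node_sexp (NNeg i) = Node [Leaf ''not'', Leaf (binary i)]"
| "node_sexp (NConj is) = Node (Leaf ''and'' # map (\<lambda>i. Leaf (binary i)) is)"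
| "node_sexp (NDisj is) = Node (Leaf ''or'' # map (\<lambda>i. Leaf (binary i)) is)"

definition encode_pair :: "atom dag \<times> atom dag \<Rightarrow> nat list" where
  "encode_pair = (\<lambda>(d1, d2). ser (Node [Node (map node_sexp d1), Node (map node_sexp d2)]))"

lemma ser_Cons: "\<exists>n w. ser x = n # w \<and> n \<noteq> 3"
proof (cases x)
  case (Leaf s) then show ?thesis by (cases s) auto
qed auto

lemma leaf_unique:
  "map (\<lambda>c. 4 + of_char c :: nat) s @ 1 # u = map (\<lambda>c. 4 + of_char c) t @ 1 # v
    \<Longrightarrow> s = t \<and> u = v"
proof (induction s arbitrary: t)
  case Nil then show ?case by (cases t) auto
next
  case (Cons c s) then show ?case by (cases t) auto
qed

lemma ser_unique: "ser x @ u = ser y @ v \<Longrightarrow> x = y \<and> u = v"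
proof (induction x arbitrary: y u v)
  case (Leaf s)
  show ?case
  proof (cases y)
    case (Leaf t) then show ?thesis using Leaf.prems leaf_unique by auto
  next
    case (Node ys) then show ?thesis using Leaf.prems by (cases s) auto
  qed
next
  case (Node xs)
  show ?case
  proof (cases y)
    case (Leaf t) then show ?thesis using Node.prems by (cases t) auto
  next
    case N: (Node ys)
    have "concat (map ser xs) @ 3 # u = concat (map ser ys) @ 3 # v \<Longrightarrow> xs = ys \<and> u = v"
      using Node.IH
    proof (induction xs arbitrary: ys)
      case Nil
      then show ?case
      proof (cases ys)
        case (Cons z zs) then show ?thesis using Nil.prems ser_Cons[of z] by auto
      qed auto
    next
      case (Cons a xs)
      show ?case
      proof (cases ys)
        case Nil then show ?thesis using Cons.prems ser_Cons[of a] by auto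
      next
        case C: (Cons z zs)
        have "ser a @ (concat (map ser xs) @ 3 # u) = ser z @ (concat (map ser zs) @ 3 # v)"
          using Cons.prems(1) C by simp
        then have "a = z \<and> concat (map ser xs) @ 3 # u = concat (map ser zs) @ 3 # v"
          by (intro Cons.prems(2)) simp_all
        with Cons.IH[of zs] Cons.prems(2) C show ?thesis by auto
      qed
    qed
    with Node.prems N show ?thesis by simp
  qed
qed

lemma inj_ser: "inj ser"
  using ser_unique[where u = "[]" and v = "[]"] by (auto intro: injI)

lemma binary_unique: "binary m = binary n \<Longrightarrow> m = n"
proof (induction m arbitrary: n rule: less_induct)
  case (less m)
  show ?case
  proof (cases "m = 0 \<or> n = 0")
    case True
    with less.prems show ?thesis by (subst (asm) (1 2) binary.simps) (auto split: if_splits)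
  next
    case False
    then have "odd m = odd n" "binary (m div 2) = binary (n div 2)"
      using less.prems by (subst (asm) (1 2) binary.simps; simp split: if_splits)+
    with less.IH[of "m div 2" "n div 2"] False have "m div 2 = n div 2" by simp
    with \<open>odd m = odd n\<close> show ?thesis by (metis dvd_mult_div_cancel odd_two_times_div_two_succ)
  qed
qed

lemma trm_sexp_unique: "trm_sexp t = trm_sexp u \<Longrightarrow> t = u"
proof (induction t arbitrary: u)
  case (Var x s) then show ?case by (cases u) auto
next
  case (App f ts)
  then obtain us where u: "u = App f us" "map trm_sexp ts = map trm_sexp us"
    by (cases u) auto
  then show ?case using App.IH by (auto simp: list_eq_iff_nth_eq dest: map_eq_imp_length_eq)
qed

lemma inj_encode_pair: "inj encode_pair"
proof -
  have inj: "inj trm_sexp" using trm_sexp_unique by (auto intro: injI)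
  have atom: "a = b" if "atom_sexp a = atom_sexp b" for a b
    using that by (cases a; cases b) (auto simp: inj_map_eq_map[OF inj] dest: trm_sexp_unique)
  have bin: "inj (\<lambda>i. Leaf (binary i))" using binary_unique by (auto intro: injI)
  have "m = n" if "node_sexp m = node_sexp n" for m n
    using that by (cases m; cases n) (auto simp: inj_map_eq_map[OF bin] dest: atom binary_unique)
  then have node: "inj node_sexp" by (auto intro: injI)
  show ?thesis
    by (rule injI)
      (auto simp: encode_pair_def inj_map_eq_map[OF node] simp del: ser.simps dest!: injD[OF inj_ser])
qed

end

theory Submission
  imports Defs
begin

text \<open>A propositional countermodel of \<open>\<psi>1 \<models> \<psi>2\<close>, restricted to \<open>\<alpha>\<close>, is a total assignment entailing
  \<open>\<not>\<psi>2\<close>.  As \<open>\<psi>2\<close> is T-extended, this assignment is T-satisfiable, and a theory interpretation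
  satisfying it agrees with the countermodel on all atoms of both formulas.  Hence on
  T-extended formulas entailment and equivalence modulo T coincide with their propositional
  counterparts, and the same machine decides both problems.\<close>

lemma eval_map_fm: "eval I (map_fm h f) = eval (I \<circ> h) f"
  by (induction f) auto

lemma eval_cong_atoms: "(\<And>a. a \<in> atoms f \<Longrightarrow> I a = J a) \<Longrightarrow> eval I f = eval J f"
proof (induction f)
  case (Conj fs)
  then have "eval I f = eval J f" if "f \<in> set fs" for f
    using that by (metis UN_I fm.set(5))
  then show ?case by simp
next
  case (Disj fs)
  then have "eval I f = eval J f" if "f \<in> set fs" for f
    using that by (metis UN_I fm.set(6))
  then show ?case by simp
qed auto

lemma p_entails_iff: "p_entails f g \<longleftrightarrow> (\<forall>I. eval I f \<longrightarrow> eval I g)"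
proof -
  have "\<exists>J. I = J \<circ> Fresh" for I :: "atom \<Rightarrow> bool"
    by (rule exI[of _ "\<lambda>v. case v of Fresh a \<Rightarrow> I a"]) (simp add: fun_eq_iff)
  then show ?thesis
    unfolding p_entails_def prop_entails_def abs_fm_def eval_map_fm by (metis (no_types))
qed

lemma total_assignment_exists:
  assumes "finite \<alpha>"
  shows "\<exists>\<rho>. total_assignment \<alpha> \<rho> \<and> (\<forall>J. eval J \<rho> \<longleftrightarrow> (\<forall>a\<in>\<alpha>. J a = I a))"
proof -
  obtain as where as: "set as = \<alpha>"
    using finite_list[OF assms] by blast
  \<comment> \<open>The literal on \<open>a\<close> that is true under \<open>I\<close>. Conjoining
    these over \<open>\<alpha>\<close> pins down exactly the values of \<open>I\<close> there;
    finiteness supplies the list that \<open>Conj\<close> takes.\<close>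
  define lit where "lit a = (if I a then Atom a else Neg (Atom a))" for a
  have "total_assignment \<alpha> (Conj (map lit as))"
    unfolding total_assignment_def
    by (rule exI[of _ "map lit as"]) (auto simp: lit_def as image_iff split: if_splits)
  moreover have "eval J (Conj (map lit as)) \<longleftrightarrow> (\<forall>a\<in>\<alpha>. J a = I a)" for J
  proof -
    have "eval J (lit a) \<longleftrightarrow> J a = I a" for a
      by (simp add: lit_def)
    then show ?thesis by (simp add: as)
  qed
  ultimately show ?thesis by blast
qed

lemma T_entails_iff_p_entails:
  assumes "finite \<alpha>" "atoms f \<subseteq> \<alpha>" "atoms g \<subseteq> \<alpha>" "T_extended T \<alpha> g"
  shows "T_entails T f g \<longleftrightarrow> p_entails f g"
proof
  assume T: "T_entails T f g"
  show "p_entails f g"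
    unfolding p_entails_iff
  proof (intro allI impI, rule ccontr)
    fix I assume I: "eval I f" "\<not> eval I g"
    obtain \<rho> where \<rho>: "total_assignment \<alpha> \<rho>" "\<And>J. eval J \<rho> \<longleftrightarrow> (\<forall>a\<in>\<alpha>. J a = I a)"
      using total_assignment_exists[OF assms(1), of I] by blast
    have agree: "eval J f = eval I f \<and> eval J g = eval I g" if "eval J \<rho>" for J
      using that assms(2,3) \<rho>(2) eval_cong_atoms[of f J I] eval_cong_atoms[of g J I] by blast
    \<comment> \<open>\<open>\<rho>\<close> fixes every atom of \<open>g\<close> to its value under
      the countermodel \<open>I\<close>, so each interpretation satisfying \<open>\<rho>\<close>
      falsifies \<open>g\<close>.\<close>
    then have "p_entails \<rho> (Neg g)"
      using I by (simp add: p_entails_iff)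
    \<comment> \<open>Otherwise \<open>\<rho>\<close> would be a member of
      \<open>P_set T \<alpha> (Neg g)\<close>, which is empty.\<close>
    then have "T_sat T \<rho>"
      using assms(4) \<rho>(1) by (auto simp: T_extended_def P_set_def)
    then show False
      using T I agree by (auto simp: T_sat_def T_entails_def)
  qed
qed (simp add: p_entails_iff T_entails_def)

lemma T_equiv_iff_T_entails: "T_equiv T f g \<longleftrightarrow> T_entails T f g \<and> T_entails T g f"
  by (auto simp: T_equiv_def T_entails_def)

text \<open>The same machine with the same time bound works: a promise problem constrains it only on
  its instances, and on those in \<open>Y\<close> the two questions have the same answer.\<close>

lemma poly_time_decidable_subproblem:
  assumes "poly_time_decidable X enc Q" "Y \<subseteq> X" "\<And>x. x \<in> Y \<Longrightarrow> Q x = R x"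
  shows "poly_time_decidable Y enc R"
proof -
  obtain M c k where M: "wf_tm M" "\<forall>x\<in>X. set (enc x) \<subseteq> {1..<num_symbols M} \<and>
      fst ((step M ^^ (c * length (enc x) ^ k + c)) (init_config (enc x))) = (if Q x then 1 else 2)"
    using assms(1) unfolding poly_time_decidable_def by blast
  have "\<forall>x\<in>Y. set (enc x) \<subseteq> {1..<num_symbols M} \<and>
      fst ((step M ^^ (c * length (enc x) ^ k + c)) (init_config (enc x))) = (if R x then 1 else 2)"
    using M(2) assms(2) by (auto simp flip: assms(3))
  with M(1) show ?thesis
    unfolding poly_time_decidable_def by blast
qed

theorem theorem5p5:
  fixes Sg :: fo_sig
    and T :: "'u struct set"
    and F :: "'p \<Rightarrow> bvar dag set"
  assumes "is_theory Sg T"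
    and "\<And>p d. d \<in> F p \<Longrightarrow> d_dnnf_dag d"
  shows
    "(poly_time_decidable (form_instances Sg F) encode_pair
        (\<lambda>(\<psi>1, \<psi>2). B_equiv (dag_fm \<psi>1) (dag_fm \<psi>2)) \<longrightarrow>
      poly_time_decidable (extended_instances Sg T F) encode_pair
        (\<lambda>(\<psi>1, \<psi>2). T_equiv T (dag_fm \<psi>1) (dag_fm \<psi>2))) \<and>
     (poly_time_decidable (form_instances Sg F) encode_pair
        (\<lambda>(\<psi>1, \<psi>2). p_entails (dag_fm \<psi>1) (dag_fm \<psi>2)) \<longrightarrow>
      poly_time_decidable (extended_instances Sg T F) encode_pair
        (\<lambda>(\<psi>1, \<psi>2). T_entails T (dag_fm \<psi>1) (dag_fm \<psi>2)))"
proof -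
  have sub: "extended_instances Sg T F \<subseteq> form_instances Sg F"
    by (auto simp: extended_instances_def)
  have entails: "p_entails (dag_fm \<psi>1) (dag_fm \<psi>2) = T_entails T (dag_fm \<psi>1) (dag_fm \<psi>2)"
    and equiv: "B_equiv (dag_fm \<psi>1) (dag_fm \<psi>2) = T_equiv T (dag_fm \<psi>1) (dag_fm \<psi>2)"
    if inst: "(\<psi>1, \<psi>2) \<in> extended_instances Sg T F" for \<psi>1 \<psi>2
  proof -
    obtain \<alpha> where "finite \<alpha>" "atoms (dag_fm \<psi>1) \<subseteq> \<alpha>" "atoms (dag_fm \<psi>2) \<subseteq> \<alpha>"
      "T_extended T \<alpha> (dag_fm \<psi>1)" "T_extended T \<alpha> (dag_fm \<psi>2)"
      using inst unfolding extended_instances_def by blast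
    \<comment> \<open>Entailment from \<open>\<psi>1\<close> to \<open>\<psi>2\<close> rests on
      \<open>\<psi>2\<close> being T-extended; for equivalence the reverse direction rests likewise
      on \<open>\<psi>1\<close>.\<close>
    then show "p_entails (dag_fm \<psi>1) (dag_fm \<psi>2) = T_entails T (dag_fm \<psi>1) (dag_fm \<psi>2)"
      and "B_equiv (dag_fm \<psi>1) (dag_fm \<psi>2) = T_equiv T (dag_fm \<psi>1) (dag_fm \<psi>2)"
      by (simp_all add: B_equiv_def T_equiv_iff_T_entails T_entails_iff_p_entails)
  qed
  show ?thesis
    by (intro conjI impI; erule poly_time_decidable_subproblem[OF _ sub]; clarsimp simp: entails equiv)
qed

end
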